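(* Let $\Omega$ be a compact metric space and let $\varphi$ be a random product of maps on a compact metric space $X$ over an invertible and ergodic measure-preserving dynamical system $(\Omega,\mathscr{F},\mathbb{P},\theta)$, where $\mathscr{F}$ is the Borel $\sigma$-algebra of $\Omega$. Suppose that the skew product $F_\varphi$ induced by $\varphi$ is continuous and that there is a unique $\varphi$-invariant measure $\mu$. Then for $\mathbb{P}$-almost every $\omega$ and every $x\in X$, $$\lim_{n\to\infty}\frac1n\sum_{i=0}^{n-1}\delta_{F_\varphi^{i}(\omega,x)}=\mu$$ in the weak$*$-topology (i.e. there is a set of full $\mathbb{P}$-measure of $\omega$'s for which the convergence holds for every $x\in X$).
   Context: Setting. $(\Omega,\mathscr{F},\mathbb{P},\theta)$ is a measure-preserving dynamical system: $\mathbb{P}$ is a probability measure and $\theta\colon\Omega\to\Omega$ is measurable and preserves $\mathbb{P}$; invertible means that $\theta$ is a bijection with measurable inverse. $X$ is a compact metric space with Borel $\sigma$-algebra $\mathscr{B}$, and $f\colon\Omega\times X\to X$ is $\mathscr{F}\otimes\mathscr{B}/\mathscr{B}$-measurable; write $f_\omega(x)=f(\omega,x)$. The random product of maps over $(\Omega,\mathscr{F},\mathbb{P},\theta)$ is $\varphi(n,\omega,x)=f_\omega^n(x)=f_{\theta^{n-1}(\omega)}\circ\cdots\circ f_\omega(x)$ for $n\ge1$, with $f_\omega^0=\mathrm{id}$. The induced skew product is $F_\varphi\colon\Omega\times X\to\Omega\times X$, $F_\varphi(\omega,x)=(\theta(\omega),f_\omega(x))$. A probability measure $\mu$ on $\Omega\times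 X$ is $\varphi$-invariant if it is $F_\varphi$-invariant and $(\Pi_1)_*\mu=\mathbb{P}$, where $\Pi_1(\omega,x)=\omega$. *)

theory Defs
  imports "HOL-Probability.Probability"
begin

section \<open>Compact metric spaces\<close>

class compact_metric_space = metric_space +
  assumes compact_UNIV: "compact UNIV"

text \<open>
  Second countability is automatic; having it as a class instance identifies the product of two
  Borel sigma-algebras with the Borel sigma-algebra of the product (\<open>borel_prod\<close>).
\<close>

lemma compact_metric_countable_base:
  assumes "compact (UNIV :: 'a :: metric_space set)"
  shows "\<exists>B :: 'a set set. countable B \<and> open = generate_topology B"
proof -
  have "\<forall>n::nat. \<exists>K :: 'a set. finite K \<and> UNIV \<subseteq> (\<Union>x\<in>K. ball x (1 / real (Suc n)))"
  proof
    fix n :: nat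
    show "\<exists>K :: 'a set. finite K \<and> UNIV \<subseteq> (\<Union>x\<in>K. ball x (1 / real (Suc n)))"
    proof (rule compactE_image[OF assms, of UNIV "\<lambda>x. ball x (1 / real (Suc n))"])
      show "open (ball x (1 / real (Suc n)))" for x :: 'a by simp
      show "(UNIV :: 'a set) \<subseteq> (\<Union>x\<in>UNIV. ball x (1 / real (Suc n)))" by fastforce
    qed blast
  qed
  then obtain K :: "nat \<Rightarrow> 'a set" where
    fin: "\<And>n. finite (K n)" and cov: "\<And>n. UNIV \<subseteq> (\<Union>x\<in>K n. ball x (1 / real (Suc n)))"
    by metis
  define B where "B = (\<Union>n. (\<lambda>x. ball x (1 / real (Suc n))) ` K n)"
  have "countable B"
    unfolding B_def using fin by (simp add: countable_finite)
  moreover have "topological_basis B"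
  proof (rule topological_basisI)
    show "open b" if "b \<in> B" for b using that by (auto simp: B_def)
    fix U :: "'a set" and y :: 'a
    assume "open U" "y \<in> U"
    then obtain e where e: "e > 0" "ball y e \<subseteq> U" using openE by blast
    obtain n where n: "1 / real (Suc n) < e / 2"
      using e(1) nat_approx_posE[of "e / 2"] by auto
    obtain x where x: "x \<in> K n" "y \<in> ball x (1 / real (Suc n))" using cov[of n] by blast
    have "ball x (1 / real (Suc n)) \<subseteq> ball y e"
    proof
      fix z assume "z \<in> ball x (1 / real (Suc n))"
      with x(2) n have "dist x z < e / 2" "dist x y < e / 2" by (auto simp del: of_nat_Suc)
      then show "z \<in> ball y e" using dist_triangle3[of y z x] by (simp add: dist_commute)
    qed
    with x e(2) show "\<exists>B'\<in>B. y \<in> B' \<and> B' \<subseteq> U"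
      unfolding B_def by (intro bexI[of _ "ball x (1 / real (Suc n))"]) auto
  qed
  ultimately show ?thesis
    using topological_basis_imp_subbasis by blast
qed

instance compact_metric_space \<subseteq> second_countable_topology
  by standard (rule compact_metric_countable_base[OF compact_UNIV])

instance prod :: (compact_metric_space, compact_metric_space) compact_metric_space
proof
  show "compact (UNIV :: ('a \<times> 'b) set)"
    using compact_Times[OF compact_UNIV compact_UNIV] by simp
qed


section \<open>Measure-preserving dynamical systems\<close>

locale mp_system = prob_space P
  for P :: "'w measure" and \<theta> :: "'w \<Rightarrow> 'w" +
  assumes base_measurable [measurable]: "\<theta> \<in> P \<rightarrow>\<^sub>M P"
    and base_preserves: "distr P P \<theta> = P"

locale invertible_mp_system = mp_system P \<theta>
  for P :: "'w measure" and \<theta> :: "'w \<Rightarrow> 'w" +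
  assumes base_bij: "bij_betw \<theta> (space P) (space P)"
    and base_inv_measurable: "the_inv_into (space P) \<theta> \<in> P \<rightarrow>\<^sub>M P"

locale ergodic_mp_system = mp_system P \<theta>
  for P :: "'w measure" and \<theta> :: "'w \<Rightarrow> 'w" +
  assumes ergodic: "\<And>A. A \<in> sets P \<Longrightarrow> \<theta> -` A \<inter> space P = A \<Longrightarrow> prob A = 0 \<or> prob A = 1"


section \<open>Random products of maps\<close>

locale random_product = mp_system P \<theta>
  for P :: "'w measure" and \<theta> :: "'w \<Rightarrow> 'w" and f :: "'w \<Rightarrow> 'x \<Rightarrow> 'x :: compact_metric_space" +
  assumes fibre_measurable [measurable]: "(\<lambda>(\<omega>, x). f \<omega> x) \<in> P \<Otimes>\<^sub>M borel \<rightarrow>\<^sub>M borel"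

primrec cocycle :: "('w \<Rightarrow> 'w) \<Rightarrow> ('w \<Rightarrow> 'x \<Rightarrow> 'x) \<Rightarrow> nat \<Rightarrow> 'w \<Rightarrow> 'x \<Rightarrow> 'x" where
  "cocycle \<theta> f 0 \<omega> = id"
| "cocycle \<theta> f (Suc n) \<omega> = f ((\<theta> ^^ n) \<omega>) \<circ> cocycle \<theta> f n \<omega>"

definition skew_product :: "('w \<Rightarrow> 'w) \<Rightarrow> ('w \<Rightarrow> 'x \<Rightarrow> 'x) \<Rightarrow> 'w \<times> 'x \<Rightarrow> 'w \<times> 'x" where
  "skew_product \<theta> f = (\<lambda>(\<omega>, x). (\<theta> \<omega>, f \<omega> x))"

lemma skew_product_funpow:
  "(skew_product \<theta> f ^^ n) (\<omega>, x) = ((\<theta> ^^ n) \<omega>, cocycle \<theta> f n \<omega> x)"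
  by (induction n) (simp_all add: skew_product_def)

definition invariant_measure :: "('a \<Rightarrow> 'a) \<Rightarrow> 'a measure \<Rightarrow> bool" where
  "invariant_measure T \<mu> \<longleftrightarrow> T \<in> \<mu> \<rightarrow>\<^sub>M \<mu> \<and> distr \<mu> \<mu> T = \<mu>"

definition cocycle_invariant ::
    "'w measure \<Rightarrow> ('w \<Rightarrow> 'w) \<Rightarrow> ('w \<Rightarrow> 'x \<Rightarrow> 'x :: compact_metric_space) \<Rightarrow>
      ('w \<times> 'x) measure \<Rightarrow> bool" where
  "cocycle_invariant P \<theta> f \<mu> \<longleftrightarrow>
     prob_space \<mu> \<and> sets \<mu> = sets (P \<Otimes>\<^sub>M borel) \<and>
     invariant_measure (skew_product \<theta> f) \<mu> \<and> distr \<mu> P fst = P"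


section \<open>Empirical measures and weak* convergence\<close>

text \<open>
  The measure \<open>1/n * (\<Sum>i<n. \<delta>(T^i z))\<close> on the sigma-algebra of \<open>M\<close>; for \<open>n = 0\<close> it is the null
  measure.
\<close>

definition empirical_measure :: "'a measure \<Rightarrow> ('a \<Rightarrow> 'a) \<Rightarrow> nat \<Rightarrow> 'a \<Rightarrow> 'a measure" where
  "empirical_measure M T n z = measure_of (space M) (sets M)
     (\<lambda>A. ennreal (1 / real n) * (\<Sum>i<n. emeasure (return M ((T ^^ i) z)) A))"

lemma sets_empirical_measure [simp, measurable_cong]:
  "sets (empirical_measure M T n z) = sets M"
  by (simp add: empirical_measure_def)

lemma space_empirical_measure [simp]: "space (empirical_measure M T n z) = space M"
  by (simp add: empirical_measure_def)

lemma emeasure_empirical_measure: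
  assumes "A \<in> sets M"
  shows "emeasure (empirical_measure M T n z) A =
    ennreal (1 / real n) * (\<Sum>i<n. emeasure (return M ((T ^^ i) z)) A)"
  unfolding empirical_measure_def
proof (rule emeasure_measure_of_sigma)
  show "sigma_algebra (space M) (sets M)" ..
  let ?m = "\<lambda>A. ennreal (1 / real n) * (\<Sum>i<n. emeasure (return M ((T ^^ i) z)) A)"
  show "positive (sets M) ?m" by (simp add: positive_def)
  show "countably_additive (sets M) ?m"
  proof (rule countably_additiveI)
    fix A :: "nat \<Rightarrow> 'a set"
    assume A: "range A \<subseteq> sets M" "disjoint_family A"
    have "(\<Sum>j. ?m (A j)) = ennreal (1 / real n) * (\<Sum>j. \<Sum>i<n. emeasure (return M ((T ^^ i) z)) (A j))"
      by simp
    also have "(\<Sum>j. \<Sum>i<n. emeasure (return M ((T ^^ i) z)) (A j)) =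
        (\<Sum>i<n. \<Sum>j. emeasure (return M ((T ^^ i) z)) (A j))"
      by (rule suminf_sum) simp
    also have "\<dots> = (\<Sum>i<n. emeasure (return M ((T ^^ i) z)) (\<Union>j. A j))"
      using A by (intro sum.cong refl suminf_emeasure) auto
    finally show "(\<Sum>j. ?m (A j)) = ?m (\<Union>j. A j)" .
  qed
qed (rule assms)

text \<open>On a compact space every continuous real function is a test function.\<close>

definition weak_star_conv :: "(nat \<Rightarrow> 'a :: compact_metric_space measure) \<Rightarrow> 'a measure \<Rightarrow> bool" where
  "weak_star_conv \<nu> \<mu> \<longleftrightarrow>
     (\<forall>g :: 'a \<Rightarrow> real. continuous_on UNIV g \<longrightarrow>
        (\<lambda>n. integral\<^sup>L (\<nu> n) g) \<longlonglongrightarrow> integral\<^sup>L \<mu> g)"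

end

theory Submission
  imports Defs
begin

text \<open>
  Fix \<open>\<omega>\<close> such that the Birkhoff averages along its orbit converge for a countable family of
  continuous functions determining \<open>P\<close>. By compactness every subsequence of the empirical measures
  of \<open>(\<omega>, x)\<close> has a weak* convergent subsequence; its limit is invariant under the continuous skew
  product, and it projects to \<open>P\<close> by the choice of \<open>\<omega>\<close>, whatever \<open>x\<close> is. Hence the limit is
  \<open>\<mu>\<close>, and the whole sequence converges to \<open>\<mu>\<close>.
\<close>

section \<open>The ergodic theorem for bounded functions\<close>

text \<open>The difficulty is the order of quantifiers: one null set of base points has to serve
  every x. An almost-everywhere statement for \<mu> on the product has exceptional sets that also
  depend on x. So the ergodic theorem is applied to P alone, and everything concerning x is left to
  compactness and to uniqueness of \<mu>.

  Each test function on the base brings its own null set, so only countably many are allowed. They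
  are the functions \<open>bump U k\<close> with U in a countable intersection-stable family of open
  sets generating the Borel sets. Each is continuous, so \<open>bump U k (fst z)\<close> is a test
  function on the product: weak* limits see it, and its averages along an orbit are Birkhoff
  averages of the base point.\<close>

context mp_system
begin

lemma base_funpow_measurable [measurable]: "(\<theta> ^^ n) \<in> P \<rightarrow>\<^sub>M P"
  by (induction n) (auto intro: measurable_comp[OF _ base_measurable])

lemma integral_base:
  fixes g :: "'w \<Rightarrow> real"
  assumes [measurable]: "g \<in> borel_measurable P"
  shows "(\<integral>\<omega>. g (\<theta> \<omega>) \<partial>P) = (\<integral>\<omega>. g \<omega> \<partial>P)"
  using integral_distr[of \<theta> P P g] base_preserves by simp

end

text \<open>\<open>max_birkhoff \<theta> g n \<omega>\<close> is the maximum of the Birkhoff sums of lengths \<open>1, \<dots>, n + 1\<close>.\<close>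

primrec max_birkhoff :: "('w \<Rightarrow> 'w) \<Rightarrow> ('w \<Rightarrow> real) \<Rightarrow> nat \<Rightarrow> 'w \<Rightarrow> real" where
  "max_birkhoff \<theta> g 0 \<omega> = g \<omega>"
| "max_birkhoff \<theta> g (Suc n) \<omega> = g \<omega> + max 0 (max_birkhoff \<theta> g n (\<theta> \<omega>))"

lemma birkhoff_sum_Suc:
  fixes g :: "'w \<Rightarrow> real"
  shows "(\<Sum>i<Suc n. g ((\<theta> ^^ i) \<omega>)) = g \<omega> + (\<Sum>i<n. g ((\<theta> ^^ i) (\<theta> \<omega>)))"
  by (simp add: sum.lessThan_Suc_shift funpow_swap1 del: sum.lessThan_Suc)

lemma birkhoff_sum_le_max: "(\<Sum>i<Suc n. g ((\<theta> ^^ i) \<omega>)) \<le> max_birkhoff \<theta> g n \<omega>"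
proof (induction n arbitrary: \<omega>)
  case (Suc n)
  then show ?case
    unfolding birkhoff_sum_Suc[where n = "Suc n"] using Suc[of "\<theta> \<omega>"] by (simp add: le_max_iff_disj)
qed simp

lemma max_birkhoff_le_Suc: "max_birkhoff \<theta> g n \<omega> \<le> max_birkhoff \<theta> g (Suc n) \<omega>"
proof (induction n arbitrary: \<omega>)
  case (Suc n)
  from Suc[of "\<theta> \<omega>"] have "max 0 (max_birkhoff \<theta> g n (\<theta> \<omega>)) \<le> max 0 (max_birkhoff \<theta> g (Suc n) (\<theta> \<omega>))"
    by (intro max.mono) auto
  then show ?case
    unfolding max_birkhoff.simps(2)[of \<theta> g _ \<omega>] by simp
qed simp

lemma incseq_max_birkhoff: "incseq (\<lambda>n. max_birkhoff \<theta> g n \<omega>)"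
  by (rule incseq_SucI) (rule max_birkhoff_le_Suc)

lemma max_birkhoff_ge: "g \<omega> \<le> max_birkhoff \<theta> g n \<omega>"
  by (cases n) auto

lemma abs_max_birkhoff_le:
  assumes "\<And>\<omega>. \<bar>g \<omega>\<bar> \<le> B"
  shows "\<bar>max_birkhoff \<theta> g n \<omega>\<bar> \<le> real (Suc n) * B"
proof (induction n arbitrary: \<omega>)
  case (Suc n)
  show ?case
    using Suc[of "\<theta> \<omega>"] assms[of \<omega>] by (auto simp: max_def algebra_simps abs_le_iff)
qed (use assms in simp)

context mp_system
begin

lemma max_birkhoff_measurable [measurable]:
  assumes [measurable]: "g \<in> borel_measurable P"
  shows "max_birkhoff \<theta> g n \<in> borel_measurable P"
proof (induction n)
  case 0
  then show ?case by (simp add: assms cong: measurable_cong)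
next
  case (Suc n)
  note [measurable] = Suc
  have "(\<lambda>\<omega>. g \<omega> + max 0 (max_birkhoff \<theta> g n (\<theta> \<omega>))) \<in> borel_measurable P"
    by measurable
  then show ?case by (simp cong: measurable_cong)
qed

end

context ergodic_mp_system
begin

text \<open>
  The set \<open>E\<close> where the Birkhoff sums are unbounded above is invariant. On \<open>E\<close> the differences
  \<open>max_birkhoff \<theta> g (n + 1) - max_birkhoff \<theta> g n \<circ> \<theta>\<close>, whose integrals are nonnegative, converge
  to \<open>g\<close>; so \<open>E\<close> cannot have full measure if \<open>g\<close> has negative mean.
\<close>

lemma birkhoff_sums_bounded_above:
  fixes g :: "'w \<Rightarrow> real"
  assumes g [measurable]: "g \<in> borel_measurable P"
    and bdd: "\<And>\<omega>. \<bar>g \<omega>\<bar> \<le> B"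
    and neg: "expectation g < 0"
  shows "AE \<omega> in P. \<exists>c. \<forall>n. (\<Sum>i<n. g ((\<theta> ^^ i) \<omega>)) \<le> c"
proof -
  let ?M = "max_birkhoff \<theta> g"
  \<comment> \<open>Natural bounds keep both quantifiers countable, which makes E measurable;
    \<open>E_iff\<close> restores real bounds.\<close>
  define E where "E = {\<omega> \<in> space P. \<forall>c::nat. \<exists>n. real c < ?M n \<omega>}"
  have E [measurable]: "E \<in> sets P"
    unfolding E_def by measurable
  have E_iff: "\<omega> \<in> E \<longleftrightarrow> (\<forall>c::real. \<exists>n. c < ?M n \<omega>)" if "\<omega> \<in> space P" for \<omega>
    unfolding E_def using that by (auto, meson reals_Archimedean2 less_trans)
  have th: "\<theta> \<omega> \<in> space P" if "\<omega> \<in> space P" for \<omega>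
    using measurable_space[OF base_measurable that] .
  have "\<omega> \<in> E \<longleftrightarrow> \<theta> \<omega> \<in> E" if w: "\<omega> \<in> space P" for \<omega>
  proof
    assume a: "\<omega> \<in> E"
    show "\<theta> \<omega> \<in> E"
      unfolding E_iff[OF th[OF w]]
    proof
      fix c :: real
      \<comment> \<open>The level is at least \<open>g \<omega>\<close>, the value at n = 0, so n is
        a successor. The summand \<open>max c 0\<close> ensures that what exceeds it is the maximum
        at \<open>\<theta> \<omega>\<close> itself and not the 0 in the recursion.\<close>
      obtain n where n: "g \<omega> + max c 0 < ?M n \<omega>" using a E_iff[OF w] by blast
      then obtain m where "n = Suc m" by (cases n) auto
      with n have "c < ?M m (\<theta> \<omega>)" by (auto simp: max_def split: if_splits)
      then show "\<exists>n. c < ?M n (\<theta> \<omega>)" ..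
    qed
  next
    assume a: "\<theta> \<omega> \<in> E"
    show "\<omega> \<in> E"
      unfolding E_iff[OF w]
    proof
      fix c :: real
      obtain n where "c - g \<omega> < ?M n (\<theta> \<omega>)" using a E_iff[OF th[OF w]] by blast
      then have "c < ?M (Suc n) \<omega>" by simp
      then show "\<exists>n. c < ?M n \<omega>" ..
    qed
  qed
  then have "\<theta> -` E \<inter> space P = E"
    by (auto simp: E_def)
  with ergodic[OF E] have "prob E = 0 \<or> prob E = 1" by blast
  moreover have "prob E \<noteq> 1"
  proof
    assume "prob E = 1"
    then have AE_E: "AE \<omega> in P. \<omega> \<in> E" using E prob_eq_1 by simp
    have AE_thE: "AE \<omega> in P. \<theta> \<omega> \<in> E"
      using AE_E \<open>\<theta> -` E \<inter> space P = E\<close> by (auto elim!: eventually_mono)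
    let ?D = "\<lambda>n \<omega>. ?M (Suc n) \<omega> - ?M n (\<theta> \<omega>)"
    \<comment> \<open>If \<open>\<theta> \<omega>\<close> lies in E, the second term vanishes as
      soon as the increasing maxima become positive.\<close>
    have D: "?D n \<omega> = g \<omega> + max 0 (- ?M n (\<theta> \<omega>))" for n \<omega> by (simp add: max_def)
    have intM: "integrable P (?M n)" for n
      using abs_max_birkhoff_le[of g, OF bdd]
      by (intro integrable_const_bound[where B = "real (Suc n) * B"]) auto
    have intMt: "integrable P (\<lambda>\<omega>. ?M n (\<theta> \<omega>))" for n
      using abs_max_birkhoff_le[of g, OF bdd]
      by (intro integrable_const_bound[where B = "real (Suc n) * B"]) auto
    have pos: "0 \<le> integral\<^sup>L P (?D n)" for n
    proof -
      have "integral\<^sup>L P (?M n) \<le> integral\<^sup>L P (?M (Suc n))"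
        by (intro integral_mono intM max_birkhoff_le_Suc)
      moreover have "integral\<^sup>L P (?D n) = integral\<^sup>L P (?M (Suc n)) - integral\<^sup>L P (\<lambda>\<omega>. ?M n (\<theta> \<omega>))"
        by (rule Bochner_Integration.integral_diff[OF intM intMt])
      moreover have "integral\<^sup>L P (\<lambda>\<omega>. ?M n (\<theta> \<omega>)) = integral\<^sup>L P (?M n)"
        by (rule integral_base) measurable
      ultimately show ?thesis by simp
    qed
    have "(\<lambda>n. integral\<^sup>L P (?D n)) \<longlonglongrightarrow> integral\<^sup>L P g"
    proof (rule integral_dominated_convergence[where w = "\<lambda>_. 2 * B"])
      show "AE \<omega> in P. (\<lambda>n. ?D n \<omega>) \<longlonglongrightarrow> g \<omega>"
        using AE_thE
      proof (eventually_elim)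
        fix \<omega> assume "\<theta> \<omega> \<in> E"
        then obtain N where N: "0 < ?M N (\<theta> \<omega>)"
          using E_iff[of "\<theta> \<omega>"] by (auto simp: E_def)
        have "?D n \<omega> = g \<omega>" if "n \<ge> N" for n
          unfolding D using N incseqD[OF incseq_max_birkhoff that, of \<theta> g "\<theta> \<omega>"] by simp
        then have "\<forall>\<^sub>F n in sequentially. ?D n \<omega> = g \<omega>"
          unfolding eventually_sequentially by blast
        then show "(\<lambda>n. ?D n \<omega>) \<longlonglongrightarrow> g \<omega>" by (rule tendsto_eventually)
      qed
      \<comment> \<open>The bound of \<open>abs_max_birkhoff_le\<close> grows with n and gives
        integrability only. A dominating constant comes from the lower bound
        \<open>max_birkhoff_ge\<close>, since just the negative part of the maximum enters.\<close>
      have "norm (?D n \<omega>) \<le> 2 * B" for n \<omega>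
        unfolding D real_norm_def
        using bdd[of \<omega>] bdd[of "\<theta> \<omega>"] max_birkhoff_ge[of g "\<theta> \<omega>" \<theta> n] by (auto simp: max_def abs_le_iff)
      then show "AE \<omega> in P. norm (?D n \<omega>) \<le> 2 * B" for n by simp
    qed (use intM intMt in auto)
    then have "0 \<le> integral\<^sup>L P g"
      by (rule LIMSEQ_le_const) (use pos in auto)
    with neg show False by simp
  qed
  ultimately have "prob E = 0" by blast
  then have "AE \<omega> in P. \<omega> \<notin> E"
    using E by (simp add: prob_eq_0)
  then show ?thesis
    using AE_space
  proof eventually_elim
    fix \<omega> assume w: "\<omega> \<notin> E" "\<omega> \<in> space P"
    then obtain c :: real where c: "\<And>n. ?M n \<omega> \<le> c"
      using E_iff[of \<omega>] by (auto simp: not_less)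
    have "(\<Sum>i<n. g ((\<theta> ^^ i) \<omega>)) \<le> max c 0" for n
    proof (cases n)
      case (Suc m)
      then show ?thesis
        using birkhoff_sum_le_max[where g = g and \<theta> = \<theta> and n = m and \<omega> = \<omega>] c[of m] by simp
    qed simp
    then show "\<exists>c. \<forall>n. (\<Sum>i<n. g ((\<theta> ^^ i) \<omega>)) \<le> c" by blast
  qed
qed

text \<open>Subtracting \<open>expectation g + e / 2\<close> leaves mean \<open>- e / 2\<close>, so
  the sums are bounded above by some c almost surely. The other half of e absorbs
  \<open>c / n\<close>.\<close>

lemma birkhoff_averages_eventually_le:
  fixes g :: "'w \<Rightarrow> real"
  assumes g [measurable]: "g \<in> borel_measurable P"
    and bdd: "\<And>\<omega>. \<bar>g \<omega>\<bar> \<le> B"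
    and "e > 0"
  shows "AE \<omega> in P. \<forall>\<^sub>F n in sequentially. (\<Sum>i<n. g ((\<theta> ^^ i) \<omega>)) / real n < expectation g + e"
proof -
  let ?a = "expectation g + e / 2"
  let ?h = "\<lambda>\<omega>. g \<omega> - ?a"
  have int: "integrable P g"
    using bdd by (intro integrable_const_bound[where B = B]) auto
  have "AE \<omega> in P. \<exists>c. \<forall>n. (\<Sum>i<n. ?h ((\<theta> ^^ i) \<omega>)) \<le> c"
  proof (rule birkhoff_sums_bounded_above)
    show "\<bar>?h \<omega>\<bar> \<le> B + \<bar>?a\<bar>" for \<omega> using bdd[of \<omega>] by linarith
    show "expectation ?h < 0"
      using int \<open>e > 0\<close> by (simp add: Bochner_Integration.integral_diff prob_space)
  qed measurable
  then show ?thesis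
  proof eventually_elim
    fix \<omega> assume "\<exists>c. \<forall>n. (\<Sum>i<n. ?h ((\<theta> ^^ i) \<omega>)) \<le> c"
    then obtain c where c: "\<And>n. (\<Sum>i<n. g ((\<theta> ^^ i) \<omega>)) - real n * ?a \<le> c"
      by (auto simp: sum_subtractf)
    have "(\<lambda>n. c / real n) \<longlonglongrightarrow> 0" by (rule lim_const_over_n)
    then have "\<forall>\<^sub>F n in sequentially. c / real n < e / 2"
      using \<open>e > 0\<close> by (intro order_tendstoD(2)) auto
    then show "\<forall>\<^sub>F n in sequentially. (\<Sum>i<n. g ((\<theta> ^^ i) \<omega>)) / real n < expectation g + e"
      using eventually_gt_at_top[of 0]
    proof eventually_elim
      fix n :: nat assume n: "c / real n < e / 2" "0 < n"
      have "(\<Sum>i<n. g ((\<theta> ^^ i) \<omega>)) / real n \<le> (c + real n * ?a) / real n"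
        using c[of n] by (intro divide_right_mono) auto
      also have "\<dots> = c / real n + ?a" using n(2) by (simp add: field_simps)
      finally show "(\<Sum>i<n. g ((\<theta> ^^ i) \<omega>)) / real n < expectation g + e" using n(1) by linarith
    qed
  qed
qed

text \<open>The upper estimate for g and for -g squeezes the averages. Taking e = 1/(k+1) keeps the
  union of the exceptional sets null.\<close>

theorem birkhoff_ergodic_bounded:
  fixes g :: "'w \<Rightarrow> real"
  assumes g [measurable]: "g \<in> borel_measurable P"
    and bdd: "\<And>\<omega>. \<bar>g \<omega>\<bar> \<le> B"
  shows "AE \<omega> in P. (\<lambda>n. (\<Sum>i<n. g ((\<theta> ^^ i) \<omega>)) / real n) \<longlonglongrightarrow> expectation g"
proof -
  let ?A = "\<lambda>g \<omega> n. (\<Sum>i<n. g ((\<theta> ^^ i) \<omega>)) / real n"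
  have "AE \<omega> in P. \<forall>k. \<forall>\<^sub>F n in sequentially. ?A g \<omega> n < expectation g + 1 / real (Suc k)"
    unfolding AE_all_countable
    by (intro allI birkhoff_averages_eventually_le[OF g bdd]) simp
  moreover have "AE \<omega> in P. \<forall>k. \<forall>\<^sub>F n in sequentially.
      ?A (\<lambda>\<omega>. - g \<omega>) \<omega> n < expectation (\<lambda>\<omega>. - g \<omega>) + 1 / real (Suc k)"
    unfolding AE_all_countable
    using bdd by (intro allI birkhoff_averages_eventually_le[where B = B]) auto
  ultimately show ?thesis
  proof eventually_elim
    case (elim \<omega>)
    show ?case
    proof (rule tendstoI)
      fix e :: real assume "e > 0"
      then obtain k where k: "1 / real (Suc k) < e" using nat_approx_posE by blast
      from elim(1)[rule_format, of k] elim(2)[rule_format, of k]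
      show "\<forall>\<^sub>F n in sequentially. dist (?A g \<omega> n) (expectation g) < e"
      proof eventually_elim
        case (elim n)
        then show ?case
          using k unfolding sum_negf minus_divide_left[symmetric] Bochner_Integration.integral_minus
            dist_real_def by linarith
      qed
    qed
  qed
qed

end


section \<open>Weak* compactness of probability measures\<close>

text \<open>Completeness is what allows a uniformly continuous map into the space to be extended to
  the closure of its domain.\<close>

instance compact_metric_space \<subseteq> complete_space
  by standard
    (metis compact_UNIV compact_imp_complete complete_UNIV Cauchy_convergent_iff complete_def convergent_def UNIV_I)

text \<open>
  Coding a point by its membership in the sets of a countable base, and the resulting binary
  sequence by a real number, gives an injection into the reals whose inverse is uniformly
  continuous although the injection itself is only Borel. This transfers Helly's selection theorem
  from the real line.
\<close>

lemma base4_digits_apart: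
  fixes a b :: "nat \<Rightarrow> bool"
  assumes "\<And>i. i < k \<Longrightarrow> a i = b i" "a k" "\<not> b k"
  shows "(1/4)^k / 2 \<le> (\<Sum>i. of_bool (a i) * (1/4::real)^i) - (\<Sum>i. of_bool (b i) * (1/4)^i)"
proof -
  have sm: "summable (\<lambda>i. of_bool (c i) * (1/4::real)^i)" for c :: "nat \<Rightarrow> bool"
    by (rule summable_comparison_test'[where g = "\<lambda>i. (1/4)^i"]) (auto intro: summable_geometric)
  let ?d = "\<lambda>i. (of_bool (a i) - of_bool (b i)) * (1/4::real)^i"
  have sd: "summable ?d"
    using summable_diff[OF sm sm, of a b] by (simp add: left_diff_distrib)
  have st: "summable (\<lambda>i. - ((1/4::real)^(i + Suc k)))"
    by (intro summable_minus summable_ignore_initial_segment summable_geometric) simp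
  \<comment> \<open>Base 4 makes all later digits together worth at most a third of digit k, leaving
    a gap of two thirds, more than the half claimed. In base 2 they could cancel digit k
    entirely.\<close>
  have "(\<Sum>i. (1/4::real)^(i + Suc k)) = (1/4)^Suc k * (\<Sum>i. (1/4)^i)"
    by (subst suminf_mult[symmetric]) (auto simp: power_add mult.commute intro: summable_geometric)
  also have "\<dots> = (1/4)^k / 3"
    by (subst suminf_geometric) auto
  finally have tail: "(\<Sum>i. - ((1/4::real)^(i + Suc k))) = - ((1/4)^k / 3)"
    using st by (subst suminf_minus) (auto dest: summable_minus)
  have "(\<Sum>i. - ((1/4::real)^(i + Suc k))) \<le> (\<Sum>i. ?d (i + Suc k))"
  proof (rule suminf_le[OF _ st])
    show "summable (\<lambda>i. ?d (i + Suc k))"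
      using sd by (rule summable_ignore_initial_segment)
    show "- ((1/4::real)^(i + Suc k)) \<le> ?d (i + Suc k)" for i
      by (cases "a (i + Suc k)"; cases "b (i + Suc k)") auto
  qed
  moreover have "(\<Sum>i. ?d i) = (\<Sum>i. ?d (i + Suc k)) + (\<Sum>i<Suc k. ?d i)"
    by (rule suminf_split_initial_segment[OF sd])
  moreover have "(\<Sum>i<Suc k. ?d i) = (1/4)^k"
    using assms by simp
  moreover have "(\<Sum>i. ?d i) = (\<Sum>i. of_bool (a i) * (1/4::real)^i) - (\<Sum>i. of_bool (b i) * (1/4)^i)"
    by (simp add: left_diff_distrib suminf_diff[OF sm sm])
  moreover have "(0::real) \<le> (1/4)^k" by simp
  ultimately show ?thesis using tail by linarith
qed

text \<open>For the last property, cover the space by finitely many base sets, each inside a ball of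
  radius r/2 and all with index below N. Codes closer than \<open>(1/4)^N / 2\<close> agree in the
  first N digits, so both points lie in a common set of the cover.\<close>

lemma compact_metric_real_code:
  obtains e :: "'a :: compact_metric_space \<Rightarrow> real"
  where "e \<in> borel_measurable borel" "range e \<subseteq> {0..2}"
    "\<And>r. r > 0 \<Longrightarrow> \<exists>d>0. \<forall>y z. \<bar>e y - e z\<bar> < d \<longrightarrow> dist y z < r"
proof -
  obtain B :: "'a set set" where B: "countable B" "topological_basis B"
    using ex_countable_basis by blast
  \<comment> \<open>Inserting \<open>UNIV\<close> guarantees a nonempty family to enumerate.\<close>
  define U where "U = from_nat_into (insert UNIV B)"
  have ranU: "range U = insert UNIV B"
    unfolding U_def using B(1) by (intro range_from_nat_into) auto
  have opU: "open (U n)" for n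
  proof -
    have "U n \<in> insert UNIV B" using ranU by blast
    then show ?thesis using topological_basis_open[OF B(2)] by auto
  qed
  define e where "e z = (\<Sum>n. of_bool (z \<in> U n) * (1/4::real)^n)" for z :: 'a
  have sm: "summable (\<lambda>i. of_bool (c i) * (1/4::real)^i)" for c :: "nat \<Rightarrow> bool"
    by (rule summable_comparison_test'[where g = "\<lambda>i. (1/4)^i"]) (auto intro: summable_geometric)
  show thesis
  proof
    have [measurable]: "U n \<in> sets borel" for n using opU by simp
    show "e \<in> borel_measurable borel"
      unfolding e_def of_bool_def by measurable
    have le: "e z \<le> (\<Sum>n. (1/4::real)^n)" for z
      unfolding e_def by (intro suminf_le sm summable_geometric) auto
    have "(\<Sum>n. (1/4::real)^n) = 4/3"
      by (subst suminf_geometric) auto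
    with le have "e z \<le> 2" for z
      using le[of z] by linarith
    moreover have "0 \<le> e z" for z
      unfolding e_def by (intro suminf_nonneg sm) auto
    ultimately show "range e \<subseteq> {0..2}"
      by auto
    fix r :: real assume "r > 0"
    have ex: "\<exists>n. y \<in> U n \<and> U n \<subseteq> ball y (r/2)" for y
    proof -
      obtain V where "V \<in> B" "y \<in> V" "V \<subseteq> ball y (r/2)"
        using topological_basisE[OF B(2), of "ball y (r/2)" y] \<open>r > 0\<close> by auto
      then show ?thesis using ranU by (metis insertI2 imageE)
    qed
    then obtain i where i: "\<And>y. y \<in> U (i y)" "\<And>y. U (i y) \<subseteq> ball y (r/2)" by metis
    obtain F where F: "finite F" "UNIV \<subseteq> (\<Union>y\<in>F. U (i y))"
      by (rule compactE_image[OF compact_UNIV, of UNIV "\<lambda>y. U (i y)"]) (use opU i in auto)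
    obtain N where N: "\<And>y. y \<in> F \<Longrightarrow> i y < N"
      using finite_nat_set_iff_bounded[of "i ` F"] F(1) by auto
    have "dist y z < r" if yz: "\<bar>e y - e z\<bar> < (1/4)^N / 2" for y z
    proof -
      have agree: "y \<in> U n \<longleftrightarrow> z \<in> U n" if "n < N" for n
      proof (rule ccontr)
        assume ne: "(y \<in> U n) \<noteq> (z \<in> U n)"
        define k where "k = (LEAST n. (y \<in> U n) \<noteq> (z \<in> U n))"
        have k: "(y \<in> U k) \<noteq> (z \<in> U k)"
          unfolding k_def by (rule LeastI[of _ n]) (rule ne)
        have kl: "(y \<in> U j) = (z \<in> U j)" if "j < k" for j
          using not_less_Least[of j "\<lambda>n. (y \<in> U n) \<noteq> (z \<in> U n)"] that unfolding k_def by blast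
        have "k \<le> n" unfolding k_def by (rule Least_le) (rule ne)
        with \<open>n < N\<close> have kN: "(1/4::real)^N \<le> (1/4)^k" by (intro power_decreasing) auto
        have "(1/4)^k / 2 \<le> \<bar>e y - e z\<bar>"
        proof (cases "y \<in> U k")
          case True
          then have "(1/4)^k / 2 \<le> e y - e z"
            unfolding e_def using kl k by (intro base4_digits_apart) auto
          then show ?thesis by linarith
        next
          case False
          then have "(1/4)^k / 2 \<le> e z - e y"
            unfolding e_def using kl k by (intro base4_digits_apart) auto
          then show ?thesis by linarith
        qed
        with kN yz show False by linarith
      qed
      obtain w where w: "w \<in> F" "y \<in> U (i w)" using F(2) by blast
      with agree N have "z \<in> U (i w)" by blast
      with w i(2)[of w] have "dist w y < r/2" "dist w z < r/2" by auto
      then show ?thesis using dist_triangle3[of y z w] by (simp add: dist_commute)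
    qed
    then show "\<exists>d>0. \<forall>y z. \<bar>e y - e z\<bar> < d \<longrightarrow> dist y z < r"
      by (intro exI[of _ "(1/4)^N / 2"]) auto
  qed
qed

lemma bounded_continuous_compact_metric:
  fixes g :: "'a :: compact_metric_space \<Rightarrow> real"
  assumes "continuous_on UNIV g"
  obtains B where "0 \<le> B" "\<And>z. \<bar>g z\<bar> \<le> B"
proof -
  have "bounded (range g)"
    using compact_continuous_image[OF assms compact_UNIV] by (rule compact_imp_bounded)
  then obtain B where "B > 0" "\<forall>x\<in>range g. norm x \<le> B" unfolding bounded_pos by blast
  then show thesis by (intro that[of B]) auto
qed

text \<open>The images under the code e live on [0, 2], so Helly's theorem applies. The range of e
  need not be closed, and the limit M may charge its closure K outside the range. Hence the inverse
  of e is extended to a continuous h on K, and the limit sought is the image of M under h.\<close>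

theorem compact_metric_weak_star_subseq:
  fixes N :: "nat \<Rightarrow> 'a :: compact_metric_space measure"
  assumes pN: "\<And>n. prob_space (N n)" and sN: "\<And>n. sets (N n) = sets borel"
  obtains r \<nu> where "strict_mono r" "prob_space \<nu>" "sets \<nu> = sets borel"
    "weak_star_conv (N \<circ> r) \<nu>"
proof -
  obtain e :: "'a \<Rightarrow> real" where e [measurable]: "e \<in> borel_measurable borel"
    and ran: "range e \<subseteq> {0..2}"
    and uc: "\<And>r. r > 0 \<Longrightarrow> \<exists>d>0. \<forall>y z. \<bar>e y - e z\<bar> < d \<longrightarrow> dist y z < r"
    using compact_metric_real_code by blast
  have inj: "inj e"
  proof (rule injI, rule ccontr)
    fix y z assume "e y = e z" "y \<noteq> z"
    moreover obtain d where "d > 0" "\<bar>e y - e z\<bar> < d \<longrightarrow> dist y z < dist y z"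
      using uc[of "dist y z"] \<open>y \<noteq> z\<close> by auto
    ultimately show False by simp
  qed
  define K where "K = closure (range e)"
  have K: "closed K" "K \<noteq> {}" by (auto simp: K_def)
  have "uniformly_continuous_on (range e) (inv e)"
    unfolding uniformly_continuous_on_def
    using uc inj by (simp add: dist_real_def) (metis abs_minus_commute)
  then obtain h where hu: "uniformly_continuous_on K h" and he: "\<And>t. t \<in> range e \<Longrightarrow> inv e t = h t"
    unfolding K_def by (rule uniformly_continuous_on_extension_on_closure) blast
  have hc: "continuous_on K h" using hu by (rule uniformly_continuous_imp_continuous)
  have h: "h (e z) = z" for z
    using he[of "e z", symmetric] inv_f_f[OF inj] by simp
  have eK: "e z \<in> K" for z unfolding K_def by (rule closure_subset[THEN subsetD]) simp
  have eN [measurable]: "e \<in> borel_measurable (N n)" for n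
    using e sN[of n] by (simp cong: measurable_cong_sets)
  let ?M = "\<lambda>n. distr (N n) borel e"
  have rd: "real_distribution (?M n)" for n
    by (rule prob_space.real_distribution_distr[OF pN eN])
  have "tight ?M"
    unfolding tight_def
  proof (intro conjI allI impI rd)
    fix \<epsilon> :: real assume "\<epsilon> > 0"
    \<comment> \<open>Tightness is phrased with left-open intervals, hence a left end below
      0.\<close>
    have "measure (?M n) {-1<..2} = 1" for n
    proof -
      have "e -` {-1<..2} \<inter> space (N n) = space (N n)"
        using ran by (auto simp: image_subset_iff) (meson dual_order.strict_trans1 zero_less_one neg_less_0_iff_less)+
      then show ?thesis
        by (simp add: measure_distr prob_space.prob_space[OF pN])
    qed
    with \<open>\<epsilon> > 0\<close> show "\<exists>a b. a < b \<and> (\<forall>n. 1 - \<epsilon> < measure (?M n) {a<..b})"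
      by (intro exI[of _ "-1"] exI[of _ 2]) auto
  qed
  then obtain r M where r: "strict_mono r" and M: "real_distribution M"
    and conv: "weak_conv_m (?M \<circ> id \<circ> r) M"
    using tight_imp_convergent_subsubsequence[of ?M id] by (auto simp: strict_mono_def)
  interpret M: real_distribution M by fact
  have int_conv: "(\<lambda>n. \<integral>z. G (e z) \<partial>N (r n)) \<longlonglongrightarrow> integral\<^sup>L M G"
    if G: "continuous_on UNIV G" "\<And>t. \<bar>G t\<bar> \<le> B" for G :: "real \<Rightarrow> real" and B
  proof -
    have Gm: "G \<in> borel_measurable borel" using G(1) by (rule borel_measurable_continuous_onI)
    have "(\<lambda>n. integral\<^sup>L ((?M \<circ> id \<circ> r) n) G) \<longlonglongrightarrow> integral\<^sup>L M G"
    proof (rule weak_conv_imp_integral_bdd_continuous_conv[OF _ M conv])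
      show "isCont G x" for x using G(1) by (simp add: continuous_on_eq_continuous_at)
    qed (use rd G in auto)
    then show ?thesis using Gm by (simp add: integral_distr)
  qed
  have AE_K: "AE t in M. t \<in> K"
  proof -
    \<comment> \<open>A bounded continuous function that vanishes exactly on the closed set K: its
      integral is 0 along the subsequence, hence 0 in the limit.\<close>
    let ?G = "\<lambda>t. min 1 (infdist t K)"
    have G: "continuous_on UNIV ?G" "\<And>t. \<bar>?G t\<bar> \<le> 1"
      using infdist_nonneg[of _ K] by (auto intro!: continuous_intros simp: abs_le_iff min.coboundedI1 le_minus_iff)
    have [measurable]: "?G \<in> borel_measurable borel" using G(1) by (rule borel_measurable_continuous_onI)
    have "(\<lambda>n. \<integral>z. ?G (e z) \<partial>N (r n)) \<longlonglongrightarrow> integral\<^sup>L M ?G"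
      by (rule int_conv[OF G])
    moreover have "?G (e z) = 0" for z using eK[of z] by simp
    ultimately have "(\<lambda>n. 0) \<longlonglongrightarrow> integral\<^sup>L M ?G" by simp
    then have "integral\<^sup>L M ?G = 0" by (simp add: LIMSEQ_const_iff)
    moreover have "integrable M ?G"
      using G(2) by (intro M.integrable_const_bound[where B = 1]) auto
    ultimately have "AE t in M. ?G t = 0"
      using infdist_nonneg[of _ K] by (subst (asm) integral_nonneg_eq_0_iff_AE) auto
    then show ?thesis
    proof eventually_elim
      fix t assume "?G t = 0"
      then show "t \<in> K" using in_closed_iff_infdist_zero[OF K, of t] by (auto simp: min_def split: if_splits)
    qed
  qed
  \<comment> \<open>Off K, an M-null set, any constant gives a Borel map.\<close>
  define h' where "h' t = (if t \<in> K then h t else h (e undefined))" for t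
  have h'_borel: "h' \<in> borel_measurable borel"
    unfolding h'_def using K(1) hc by (intro borel_measurable_continuous_on_if) auto
  then have h' [measurable]: "h' \<in> borel_measurable M"
    by (simp cong: measurable_cong_sets)
  let ?nu = "distr M borel h'"
  show thesis
  proof
    show "strict_mono r" by fact
    show "prob_space ?nu" by (rule M.prob_space_distr[OF h'])
    show "sets ?nu = sets borel" by simp
    show "weak_star_conv (N \<circ> r) ?nu"
      unfolding weak_star_conv_def
    proof (intro allI impI)
      fix g :: "'a \<Rightarrow> real" assume g: "continuous_on UNIV g"
      then have gm [measurable]: "g \<in> borel_measurable borel" by (rule borel_measurable_continuous_onI)
      obtain B where B: "0 \<le> B" "\<And>z. \<bar>g z\<bar> \<le> B" using bounded_continuous_compact_metric[OF g] by blast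
      have "continuous_on K (\<lambda>t. g (h t))"
        using continuous_on_compose2[OF g hc] by simp
      \<comment> \<open>Tietze turns \<open>g \<circ> h\<close> into a test function on the whole
        line with the same bound; on codes it returns g.\<close>
      then obtain G where G: "continuous_on UNIV G" "\<And>t. t \<in> K \<Longrightarrow> G t = g (h t)" "\<And>t. \<bar>G t\<bar> \<le> B"
      proof (rule Tietze)
        show "closedin (top_of_set UNIV) K" using K(1) by simp
      qed (use B in auto)
      have [measurable]: "G \<in> borel_measurable borel" using G(1) by (rule borel_measurable_continuous_onI)
      have "(\<lambda>n. \<integral>z. G (e z) \<partial>N (r n)) \<longlonglongrightarrow> integral\<^sup>L M G"
        by (rule int_conv[OF G(1,3)])
      moreover have "G (e z) = g z" for z using G(2)[OF eK] h by simp
      moreover have "integral\<^sup>L M G = integral\<^sup>L M (\<lambda>t. g (h' t))"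
      proof (rule integral_cong_AE)
        show "AE t in M. G t = g (h' t)"
          using AE_K by eventually_elim (simp add: G(2) h'_def)
      qed measurable
      moreover have "integral\<^sup>L ?nu g = integral\<^sup>L M (\<lambda>t. g (h' t))"
        by (rule integral_distr[OF h' gm])
      ultimately show "(\<lambda>n. integral\<^sup>L ((N \<circ> r) n) g) \<longlonglongrightarrow> integral\<^sup>L ?nu g" by simp
    qed
  qed
qed


section \<open>Empirical measures and their limits\<close>

text \<open>The empirical measure is the image of the uniform measure on the times below n under the
  orbit map. For n = 0 both sides are 0.\<close>

lemma integral_empirical_measure:
  fixes g :: "'a \<Rightarrow> real"
  assumes orb: "\<And>i. (T ^^ i) z \<in> space M" and g: "g \<in> borel_measurable M"
  shows "integral\<^sup>L (empirical_measure M T n z) g = (\<Sum>i<n. g ((T ^^ i) z)) / real n"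
proof -
  let ?C = "uniform_count_measure {..<n}"
  have m: "(\<lambda>i. (T ^^ i) z) \<in> ?C \<rightarrow>\<^sub>M M"
    using orb by (auto simp: measurable_def sets_uniform_count_measure space_uniform_count_measure)
  have "empirical_measure M T n z = distr ?C M (\<lambda>i. (T ^^ i) z)"
  proof (rule measure_eqI)
    fix A assume "A \<in> sets (empirical_measure M T n z)"
    then have A: "A \<in> sets M" by simp
    let ?S = "{i \<in> {..<n}. (T ^^ i) z \<in> A}"
    have "(\<Sum>i<n. emeasure (return M ((T ^^ i) z)) A) = (\<Sum>i<n. of_bool ((T ^^ i) z \<in> A))"
      using A by (intro sum.cong) (auto simp: indicator_def)
    also have "\<dots> = ennreal (real (card ?S))"
      by (simp add: Int_def ennreal_of_nat_eq_real_of_nat conj_commute)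
    finally have "emeasure (empirical_measure M T n z) A = ennreal (real (card ?S) / real n)"
      by (simp add: emeasure_empirical_measure[OF A] ennreal_mult[symmetric])
    also have "\<dots> = emeasure ?C ?S"
      by (subst emeasure_uniform_count_measure) auto
    also have "?S = (\<lambda>i. (T ^^ i) z) -` A \<inter> space ?C"
      by (auto simp: space_uniform_count_measure)
    finally show "emeasure (empirical_measure M T n z) A = emeasure (distr ?C M (\<lambda>i. (T ^^ i) z)) A"
      using A by (simp add: emeasure_distr[OF m])
  qed simp
  then show ?thesis
    using integral_distr[OF m g] by (simp add: integral_uniform_count_measure)
qed

lemma prob_space_empirical_measure:
  assumes "\<And>i. (T ^^ i) z \<in> space M" "n > 0"
  shows "prob_space (empirical_measure M T n z)"
proof
  have "emeasure (empirical_measure M T n z) (space M) = ennreal (1 / real n) * of_nat n"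
    using assms(1) by (simp add: emeasure_empirical_measure)
  also have "\<dots> = ennreal (1 / real n * real n)"
    by (subst ennreal_mult) (auto simp: ennreal_of_nat_eq_real_of_nat)
  finally show "emeasure (empirical_measure M T n z) (space (empirical_measure M T n z)) = 1"
    using \<open>n > 0\<close> by simp
qed


section \<open>Measures determined by continuous functions, and invariance of weak* limits\<close>

text \<open>
  For \<open>U = UNIV\<close> this is the zero function, because \<^term>\<open>infdist z {} = 0\<close>; otherwise it
  increases to the indicator of the open set \<open>U\<close> as \<open>k\<close> tends to infinity.
\<close>

definition bump :: "'a :: metric_space set \<Rightarrow> nat \<Rightarrow> 'a \<Rightarrow> real" where
  "bump U k z = min 1 (real k * infdist z (- U))"

lemma continuous_on_bump: "continuous_on A (bump U k)"
  unfolding bump_def by (intro continuous_intros)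

lemma abs_bump_le_1: "\<bar>bump U k z\<bar> \<le> 1"
  using infdist_nonneg[of z "- U"] by (simp add: bump_def min_def)

lemma bump_borel_measurable [measurable]: "bump U k \<in> borel_measurable borel"
  by (rule borel_measurable_continuous_onI) (rule continuous_on_bump)

lemma bump_tendsto_indicator:
  assumes "open U" "U \<noteq> UNIV"
  shows "(\<lambda>k. bump U k z) \<longlonglongrightarrow> indicator U z"
proof (cases "z \<in> U")
  case True
  have "infdist z (- U) > 0"
    using assms True by (intro infdist_pos_not_in_closed) (auto simp: closed_def)
  then have "filterlim (\<lambda>k. real k * infdist z (- U)) at_top sequentially"
    by (intro filterlim_at_top_mult_tendsto_pos[OF tendsto_const] filterlim_real_sequentially)
  then have "\<forall>\<^sub>F k in sequentially. 1 \<le> real k * infdist z (- U)"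
    unfolding filterlim_at_top by blast
  then have "\<forall>\<^sub>F k in sequentially. bump U k z = 1"
    by eventually_elim (simp add: bump_def)
  then show ?thesis using True by (simp add: tendsto_eventually)
next
  case False
  then show ?thesis by (simp add: bump_def)
qed

lemma integral_bump_tendsto_measure:
  assumes "prob_space M" and sets [measurable_cong]: "sets M = sets borel"
    and U: "open U" "U \<noteq> UNIV"
  shows "(\<lambda>k. integral\<^sup>L M (bump U k)) \<longlonglongrightarrow> measure M U"
proof -
  interpret prob_space M by fact
  have [measurable]: "U \<in> sets borel" using U by simp
  have "(\<lambda>k. integral\<^sup>L M (bump U k)) \<longlonglongrightarrow> integral\<^sup>L M (indicator U :: _ \<Rightarrow> real)"
  proof (rule integral_dominated_convergence[where w = "\<lambda>_. 1"])
    show "AE z in M. (\<lambda>k. bump U k z) \<longlonglongrightarrow> indicator U z"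
      using bump_tendsto_indicator[OF U] by simp
  qed (use abs_bump_le_1 in auto)
  moreover have "space M = UNIV" using sets_eq_imp_space_eq[OF sets] by simp
  ultimately show ?thesis by simp
qed

text \<open>Bump integrals recover the measure of each proper open set in the generator, so a
  countable generator yields a countable determining family. For \<open>UNIV\<close> the bumps
  vanish, and total mass 1 replaces them.\<close>

lemma prob_measure_eqI_bump:
  assumes M: "prob_space M" "sets M = sets borel" and N: "prob_space N" "sets N = sets borel"
    and E: "Int_stable E" "sigma_sets UNIV E = sets borel" "UNIV \<in> E" "\<And>U. U \<in> E \<Longrightarrow> open U"
    and eq: "\<And>U k. U \<in> E \<Longrightarrow> integral\<^sup>L M (bump U k) = integral\<^sup>L N (bump U k)"
  shows "M = N"
proof (rule measure_eqI_generator_eq[where E = E and \<Omega> = UNIV and A = "\<lambda>_. UNIV"])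
  interpret M: prob_space M by fact
  interpret N: prob_space N by fact
  have sp: "space M = UNIV" "space N = UNIV"
    using sets_eq_imp_space_eq[OF M(2)] sets_eq_imp_space_eq[OF N(2)] by auto
  fix U assume U: "U \<in> E"
  show "emeasure M U = emeasure N U"
  proof (cases "U = UNIV")
    case True
    then show ?thesis using M.emeasure_space_1 N.emeasure_space_1 sp by simp
  next
    case False
    have "measure M U = measure N U"
      using integral_bump_tendsto_measure[OF M E(4)[OF U] False]
        integral_bump_tendsto_measure[OF N E(4)[OF U] False]
      by (simp add: eq[OF U] LIMSEQ_unique)
    then show ?thesis by (simp add: M.emeasure_eq_measure N.emeasure_eq_measure)
  qed
qed (use assms in \<open>auto simp: prob_space.emeasure_space_1 prob_space.finite_measure finite_measure.emeasure_finite\<close>)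

text \<open>Finite intersections of a countable base; the empty intersection supplies
  \<open>UNIV\<close>.\<close>

lemma countable_Int_stable_open_generator:
  obtains E :: "'a :: second_countable_topology set set"
  where "countable E" "Int_stable E" "sigma_sets UNIV E = sets borel" "UNIV \<in> E"
    "\<And>U. U \<in> E \<Longrightarrow> open U"
proof -
  obtain B :: "'a set set" where B: "countable B" "topological_basis B"
    using ex_countable_basis by blast
  define E where "E = Inter ` {F. finite F \<and> F \<subseteq> B}"
  have opE: "open U" if "U \<in> E" for U
    using that topological_basis_open[OF B(2)] by (auto simp: E_def intro!: open_Inter)
  show thesis
  proof
    show "countable E"
      unfolding E_def by (intro countable_image countable_Collect_finite_subset B)
    show "Int_stable E"
    proof (rule Int_stableI)
      fix a b assume "a \<in> E" "b \<in> E"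
      then obtain F G where "finite F" "F \<subseteq> B" "a = \<Inter>F" "finite G" "G \<subseteq> B" "b = \<Inter>G"
        by (auto simp: E_def)
      then show "a \<inter> b \<in> E"
        unfolding E_def by (intro image_eqI[of _ _ "F \<union> G"]) auto
    qed
    show "UNIV \<in> E" unfolding E_def by (intro image_eqI[of _ _ "{}"]) auto
    have "B \<subseteq> E"
    proof
      fix b assume "b \<in> B"
      then show "b \<in> E" unfolding E_def by (intro image_eqI[of _ _ "{b}"]) auto
    qed
    have "sets borel = sigma_sets UNIV B"
      by (subst borel_eq_countable_basis[OF B]) simp
    also have "\<dots> \<subseteq> sigma_sets UNIV E" using \<open>B \<subseteq> E\<close> by (rule sigma_sets_mono')
    finally have "sets borel \<subseteq> sigma_sets UNIV E" .
    moreover have "sigma_sets UNIV E \<subseteq> sets borel"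
      using opE by (intro sets.sigma_sets_subset[of _ borel, simplified]) auto
    ultimately show "sigma_sets UNIV E = sets borel" by blast
  qed (rule opE)
qed

lemma prob_measure_eqI_continuous:
  fixes M N :: "'a :: metric_space measure"
  assumes "prob_space M" "sets M = sets borel" "prob_space N" "sets N = sets borel"
    and "\<And>g :: 'a \<Rightarrow> real. continuous_on UNIV g \<Longrightarrow> integral\<^sup>L M g = integral\<^sup>L N g"
  shows "M = N"
proof (rule prob_measure_eqI_bump[where E = "{U. open U}"])
  show "sigma_sets UNIV {U. open U} = sets borel" by (simp add: borel_def)
  show "integral\<^sup>L M (bump U k) = integral\<^sup>L N (bump U k)" for U k
    by (rule assms(5)) (rule continuous_on_bump)
qed (use assms(1-4) in \<open>auto simp: Int_stable_def\<close>)

text \<open>The Krylov-Bogolyubov argument: the averages of \<open>g \<circ> T\<close> and g over m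
  steps telescope to a difference of at most \<open>2 * B / m\<close>. Continuity of T makes
  \<open>g \<circ> T\<close> a test function as well.\<close>

theorem empirical_limit_invariant:
  fixes T :: "'a :: compact_metric_space \<Rightarrow> 'a"
  assumes sets: "sets M = sets borel" and T: "continuous_on UNIV T"
    and r: "strict_mono r"
    and nu: "prob_space \<nu>" "sets \<nu> = sets borel"
    and conv: "weak_star_conv (\<lambda>n. empirical_measure M T (r n) z) \<nu>"
  shows "distr \<nu> borel T = \<nu>"
proof -
  have sp: "space M = UNIV" using sets_eq_imp_space_eq[OF sets] by simp
  have T_borel: "T \<in> borel_measurable borel" using T by (rule borel_measurable_continuous_onI)
  then have Tm: "T \<in> borel_measurable \<nu>" using nu(2) by (simp cong: measurable_cong_sets)
  have avg: "(\<lambda>n. (\<Sum>i<r n. g ((T ^^ i) z)) / real (r n)) \<longlonglongrightarrow> integral\<^sup>L \<nu> g"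
    if g: "continuous_on UNIV g" for g :: "'a \<Rightarrow> real"
  proof -
    have "g \<in> borel_measurable M"
      using borel_measurable_continuous_onI[OF g] sets by (simp cong: measurable_cong_sets)
    then have "integral\<^sup>L (empirical_measure M T n z) g = (\<Sum>i<n. g ((T ^^ i) z)) / real n" for n
      by (intro integral_empirical_measure) (simp_all add: sp)
    moreover have "(\<lambda>n. integral\<^sup>L (empirical_measure M T (r n) z) g) \<longlonglongrightarrow> integral\<^sup>L \<nu> g"
      using conv g unfolding weak_star_conv_def by blast
    ultimately show ?thesis by simp
  qed
  show ?thesis
  proof (rule prob_measure_eqI_continuous)
    show "prob_space (distr \<nu> borel T)" by (rule prob_space.prob_space_distr[OF nu(1) Tm])
    fix g :: "'a \<Rightarrow> real" assume g: "continuous_on UNIV g"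
    obtain B where B: "0 \<le> B" "\<And>z. \<bar>g z\<bar> \<le> B" using bounded_continuous_compact_metric[OF g] by blast
    have gT: "continuous_on UNIV (\<lambda>z. g (T z))" using continuous_on_compose2[OF g T] by simp
    have "(\<lambda>n. (\<Sum>i<r n. g (T ((T ^^ i) z))) / real (r n) - (\<Sum>i<r n. g ((T ^^ i) z)) / real (r n))
        \<longlonglongrightarrow> integral\<^sup>L \<nu> (\<lambda>z. g (T z)) - integral\<^sup>L \<nu> g"
      by (intro tendsto_diff avg[OF gT] avg[OF g])
    moreover have "(\<lambda>n. (\<Sum>i<r n. g (T ((T ^^ i) z))) / real (r n) - (\<Sum>i<r n. g ((T ^^ i) z)) / real (r n)) \<longlonglongrightarrow> 0"
    proof (rule Lim_null_comparison)
      have tele: "(\<Sum>i<m. g (T ((T ^^ i) z))) - (\<Sum>i<m. g ((T ^^ i) z)) = g ((T ^^ m) z) - g z" for m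
        by (induction m) auto
      have "norm ((\<Sum>i<m. g (T ((T ^^ i) z))) / real m - (\<Sum>i<m. g ((T ^^ i) z)) / real m) \<le> 2 * B / real m" for m
        unfolding diff_divide_distrib[symmetric] tele
        using B(2)[of z] B(2)[of "(T ^^ m) z"] by (auto simp: abs_divide intro!: divide_right_mono)
      then show "\<forall>\<^sub>F n in sequentially. norm ((\<Sum>i<r n. g (T ((T ^^ i) z))) / real (r n)
          - (\<Sum>i<r n. g ((T ^^ i) z)) / real (r n)) \<le> 2 * B / real (r n)" by simp
      show "(\<lambda>n. 2 * B / real (r n)) \<longlonglongrightarrow> 0"
        using LIMSEQ_subseq_LIMSEQ[OF lim_const_over_n[of "2 * B"] r] by (simp add: o_def)
    qed
    ultimately have "integral\<^sup>L \<nu> (\<lambda>z. g (T z)) - integral\<^sup>L \<nu> g = 0"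
      by (rule LIMSEQ_unique)
    then show "integral\<^sup>L (distr \<nu> borel T) g = integral\<^sup>L \<nu> g"
      using integral_distr[OF Tm borel_measurable_continuous_onI[OF g]] by simp
  qed (use nu in auto)
qed

section \<open>From subsequential limits to convergence on every fibre\<close>

theorem theorem2:
  fixes P :: "'w :: compact_metric_space measure"
    and \<theta> :: "'w \<Rightarrow> 'w"
    and f :: "'w \<Rightarrow> 'x \<Rightarrow> 'x :: compact_metric_space"
    and \<mu> :: "('w \<times> 'x) measure"
  assumes "sets P = sets borel"
    and "invertible_mp_system P \<theta>"
    and "ergodic_mp_system P \<theta>"
    and "random_product P \<theta> f"
    and "continuous_on UNIV (skew_product \<theta> f)"
    and "cocycle_invariant P \<theta> f \<mu>"
    and "\<And>\<nu>. cocycle_invariant P \<theta> f \<nu> \<Longrightarrow> \<nu> = \<mu>"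
  shows "AE \<omega> in P. \<forall>x.
    weak_star_conv (\<lambda>n. empirical_measure (P \<Otimes>\<^sub>M borel) (skew_product \<theta> f) n (\<omega>, x)) \<mu>"
proof -
  interpret ergodic_mp_system P \<theta> by fact
  let ?T = "skew_product \<theta> f"
  let ?Q = "P \<Otimes>\<^sub>M (borel :: 'x measure)"
  have "sets ?Q = sets ((borel :: 'w measure) \<Otimes>\<^sub>M (borel :: 'x measure))"
    by (rule sets_pair_measure_cong[OF assms(1) refl])
  then have sQ: "sets ?Q = sets borel" by (simp only: borel_prod)
  have spQ: "space ?Q = UNIV" using sets_eq_imp_space_eq[OF sQ] by simp
  obtain E :: "'w set set" where E: "countable E" "Int_stable E" "sigma_sets UNIV E = sets borel"
    "UNIV \<in> E" "\<And>U. U \<in> E \<Longrightarrow> open U"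
    using countable_Int_stable_open_generator by blast
  have bumpP: "bump U k \<in> borel_measurable P" for U :: "'w set" and k
    using assms(1) by (simp cong: measurable_cong_sets)
  have "AE \<omega> in P. \<forall>U\<in>E. \<forall>k.
      (\<lambda>n. (\<Sum>i<n. bump U k ((\<theta> ^^ i) \<omega>)) / real n) \<longlonglongrightarrow> expectation (bump U k)"
    unfolding AE_ball_countable[OF E(1)] AE_all_countable
    by (intro ballI allI birkhoff_ergodic_bounded[OF bumpP abs_bump_le_1])
  then show ?thesis
  proof eventually_elim
    fix \<omega>
    assume generic: "\<forall>U\<in>E. \<forall>k.
      (\<lambda>n. (\<Sum>i<n. bump U k ((\<theta> ^^ i) \<omega>)) / real n) \<longlonglongrightarrow> expectation (bump U k)"
    show "\<forall>x. weak_star_conv (\<lambda>n. empirical_measure ?Q ?T n (\<omega>, x)) \<mu>"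
    proof
      fix x
      let ?N = "\<lambda>n. empirical_measure ?Q ?T n (\<omega>, x)"
      have limit: "\<nu> = \<mu>" if s: "strict_mono s" and nu: "prob_space \<nu>" "sets \<nu> = sets borel"
        and conv: "weak_star_conv (\<lambda>n. ?N (s n)) \<nu>" for s :: "nat \<Rightarrow> nat" and \<nu>
      proof (rule assms(7))
        interpret nu: prob_space \<nu> by fact
        have fst_m: "fst \<in> \<nu> \<rightarrow>\<^sub>M P"
        proof -
          have "(fst :: 'w \<times> 'x \<Rightarrow> 'w) \<in> borel_measurable borel"
            by (intro borel_measurable_continuous_onI continuous_intros)
          then show ?thesis
            using nu(2) assms(1) by (simp cong: measurable_cong_sets)
        qed
        have "?T \<in> borel_measurable borel"
          using assms(5) by (rule borel_measurable_continuous_onI)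
        then have T_m: "?T \<in> \<nu> \<rightarrow>\<^sub>M \<nu>"
          using nu(2) by (simp cong: measurable_cong_sets)
        have "distr \<nu> \<nu> ?T = distr \<nu> borel ?T"
          by (rule distr_cong) (use nu(2) in auto)
        also have "\<dots> = \<nu>"
          by (rule empirical_limit_invariant[OF sQ assms(5) s nu conv])
        finally have "invariant_measure ?T \<nu>"
          using T_m by (simp add: invariant_measure_def)
        moreover have "distr \<nu> P fst = P"
        proof (rule prob_measure_eqI_bump[where E = E])
          fix U k assume U: "U \<in> E"
          have c: "continuous_on UNIV (\<lambda>z :: 'w \<times> 'x. bump U k (fst z))"
            by (intro continuous_on_compose2[OF continuous_on_bump[of UNIV]] continuous_intros) simp
          then have m: "(\<lambda>z :: 'w \<times> 'x. bump U k (fst z)) \<in> borel_measurable ?Q"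
            using borel_measurable_continuous_onI[OF c] sQ by (simp cong: measurable_cong_sets)
          have "(\<lambda>n. integral\<^sup>L (?N (s n)) (\<lambda>z. bump U k (fst z))) \<longlonglongrightarrow> integral\<^sup>L \<nu> (\<lambda>z. bump U k (fst z))"
            using conv c unfolding weak_star_conv_def by blast
          \<comment> \<open>The first coordinate of the orbit is the \<theta>-orbit of \<omega>, so
            x drops out here.\<close>
          then have "(\<lambda>n. (\<Sum>i<s n. bump U k ((\<theta> ^^ i) \<omega>)) / real (s n)) \<longlonglongrightarrow> integral\<^sup>L \<nu> (\<lambda>z. bump U k (fst z))"
            using m by (simp add: integral_empirical_measure spQ skew_product_funpow)
          moreover have "(\<lambda>n. (\<Sum>i<s n. bump U k ((\<theta> ^^ i) \<omega>)) / real (s n)) \<longlonglongrightarrow> expectation (bump U k)"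
            using LIMSEQ_subseq_LIMSEQ[OF generic[rule_format, OF U] s] by (simp add: o_def)
          ultimately have "integral\<^sup>L \<nu> (\<lambda>z. bump U k (fst z)) = expectation (bump U k)"
            by (rule LIMSEQ_unique)
          then show "integral\<^sup>L (distr \<nu> P fst) (bump U k) = expectation (bump U k)"
            using integral_distr[OF fst_m bumpP] by simp
        qed (use E assms(1) nu.prob_space_distr[OF fst_m] prob_space_axioms in auto)
        ultimately show "cocycle_invariant P \<theta> f \<nu>"
          unfolding cocycle_invariant_def using nu sQ by simp
      qed
      show "weak_star_conv ?N \<mu>"
        unfolding weak_star_conv_def
      proof (intro allI impI, rule ccontr)
        fix g :: "'w \<times> 'x \<Rightarrow> real"
        assume g: "continuous_on UNIV g"
          and "\<not> (\<lambda>n. integral\<^sup>L (?N n) g) \<longlonglongrightarrow> integral\<^sup>L \<mu> g"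
        then obtain e where e: "e > 0"
          "\<not> (\<forall>\<^sub>F n in sequentially. dist (integral\<^sup>L (?N n) g) (integral\<^sup>L \<mu> g) < e)"
          unfolding tendsto_iff by blast
        define S where "S = {n. e \<le> dist (integral\<^sup>L (?N n) g) (integral\<^sup>L \<mu> g)}"
        have "infinite S"
          using e(2) unfolding cofinite_eq_sequentially[symmetric] eventually_cofinite S_def
          by (simp add: not_less)
        \<comment> \<open>Index 0 gives the null measure, whereas weak* compactness is applied to
          probability measures.\<close>
        then have "infinite (S - {0})" by simp
        then obtain r :: "nat \<Rightarrow> nat" where r: "strict_mono r" "\<And>n. r n \<in> S - {0}"
          using infinite_enumerate by blast
        have "prob_space (?N (r n))" for n
          using r(2)[of n] by (intro prob_space_empirical_measure) (auto simp: spQ)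
        then obtain r' \<nu> where r': "strict_mono r'" and nu: "prob_space \<nu>" "sets \<nu> = sets borel"
          "weak_star_conv ((\<lambda>n. ?N (r n)) \<circ> r') \<nu>"
          using compact_metric_weak_star_subseq[of "\<lambda>n. ?N (r n)"] sQ by auto
        have "\<nu> = \<mu>"
          using limit[OF strict_mono_o[OF r(1) r'] nu(1,2)] nu(3) by (simp add: o_def)
        with nu(3) g have "(\<lambda>n. integral\<^sup>L (?N (r (r' n))) g) \<longlonglongrightarrow> integral\<^sup>L \<mu> g"
          by (simp add: weak_star_conv_def o_def)
        then have "\<forall>\<^sub>F n in sequentially. dist (integral\<^sup>L (?N (r (r' n))) g) (integral\<^sup>L \<mu> g) < e"
          using e(1) by (rule tendstoD)
        then obtain n where "dist (integral\<^sup>L (?N (r (r' n))) g) (integral\<^sup>L \<mu> g) < e"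
          by (auto simp: eventually_sequentially)
        with r(2)[of "r' n"] show False by (simp add: S_def)
      qed
    qed
  qed
qed

end
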